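(* For every purely modal formula $A$ (no $\blacksquare$, no $\lozenge^{\bullet}$), $A$ is derivable in $\mathbf{DKS4}$ iff $A$ is a theorem of S4.
   Context: Formulae are in negation normal form over $a,\neg a,\lor,\land,\square,\blacksquare,\lozenge,\lozenge^{\bullet}$, where $\lozenge^{\bullet}$ is the past diamond (dual of $\blacksquare$). Nested sequents are multisets of formulae and structures $\circ\{\Gamma\}$, $\bullet\{\Delta\}$; $\Sigma[\,]$ is a context with a hole at any depth. $\mathbf{DKS4}$ consists of the rules: $id$: $\Sigma[a,\overline a]$; $\land$: from $\Sigma[A\land B,A]$ and $\Sigma[A\land B,B]$ infer $\Sigma[A\land B]$; $\lor$: from $\Sigma[A\lor B,A,B]$ infer $\Sigma[A\lor B]$; $\square$: from $\Sigma[\square A,\circ\{A\}]$ infer $\Sigma[\square A]$; $\lozenge_1$: from $\Sigma[\circ\{\Delta,A\},\lozenge A]$ infer $\Sigma[\circ\{\Delta\},\lozenge A]$; $T_b$: from $\Sigma[\lozenge A,A]$ infer $\Sigma[\lozenge A]$; $4_c$: from $\Sigma[\lozenge A,\circ\{\lozenge A,\Delta\}]$ infer $\Sigma[\lozenge A,\circ\{\Delta\}]$. *)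

theory Defs
  imports "HOL-Library.Multiset"
begin

datatype 'a fm =
    Atom 'a
  | NAtom 'a
  | Or "'a fm" "'a fm"
  | And "'a fm" "'a fm"
  | Box "'a fm"
  | BBox "'a fm"
  | Dia "'a fm"
  | BDia "'a fm"

text \<open>\<open>BBox\<close> and \<open>BDia\<close> are the past box and the past diamond. All formulae are in
  negation normal form, so negation and implication are defined operations.\<close>

primrec neg :: "'a fm \<Rightarrow> 'a fm" where
  "neg (Atom a) = NAtom a"
| "neg (NAtom a) = Atom a"
| "neg (Or A B) = And (neg A) (neg B)"
| "neg (And A B) = Or (neg A) (neg B)"
| "neg (Box A) = Dia (neg A)"
| "neg (BBox A) = BDia (neg A)"
| "neg (Dia A) = Box (neg A)"
| "neg (BDia A) = BBox (neg A)"

definition imp :: "'a fm \<Rightarrow> 'a fm \<Rightarrow> 'a fm" where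
  "imp A B = Or (neg A) B"

primrec modal :: "'a fm \<Rightarrow> bool" where
  "modal (Atom a) \<longleftrightarrow> True"
| "modal (NAtom a) \<longleftrightarrow> True"
| "modal (Or A B) \<longleftrightarrow> modal A \<and> modal B"
| "modal (And A B) \<longleftrightarrow> modal A \<and> modal B"
| "modal (Box A) \<longleftrightarrow> modal A"
| "modal (BBox A) \<longleftrightarrow> False"
| "modal (Dia A) \<longleftrightarrow> modal A"
| "modal (BDia A) \<longleftrightarrow> False"

datatype 'a item =
    Fm "'a fm"
  | White "'a item multiset"
  | Black "'a item multiset"

type_synonym 'a nseq = "'a item multiset"

text \<open>Contexts with exactly one hole. Each constructor carries the side items standing next
  to the hole, or next to the structure that contains the hole.\<close>

datatype 'a ctx =
    Hole "'a nseq"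
  | InWhite "'a nseq" "'a ctx"
  | InBlack "'a nseq" "'a ctx"

primrec fill :: "'a ctx \<Rightarrow> 'a nseq \<Rightarrow> 'a nseq" where
  "fill (Hole \<Gamma>) X = \<Gamma> + X"
| "fill (InWhite \<Gamma> \<Sigma>) X = add_mset (White (fill \<Sigma> X)) \<Gamma>"
| "fill (InBlack \<Gamma> \<Sigma>) X = add_mset (Black (fill \<Sigma> X)) \<Gamma>"

inductive DKS4 :: "'a nseq \<Rightarrow> bool" where
  id: "DKS4 (fill \<Sigma> {#Fm (Atom a), Fm (NAtom a)#})"
| conj: "DKS4 (fill \<Sigma> {#Fm (And A B), Fm A#}) \<Longrightarrow> DKS4 (fill \<Sigma> {#Fm (And A B), Fm B#}) \<Longrightarrow>
    DKS4 (fill \<Sigma> {#Fm (And A B)#})"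
| disj: "DKS4 (fill \<Sigma> {#Fm (Or A B), Fm A, Fm B#}) \<Longrightarrow> DKS4 (fill \<Sigma> {#Fm (Or A B)#})"
| box: "DKS4 (fill \<Sigma> {#Fm (Box A), White {#Fm A#}#}) \<Longrightarrow> DKS4 (fill \<Sigma> {#Fm (Box A)#})"
| dia1: "DKS4 (fill \<Sigma> {#White (\<Delta> + {#Fm A#}), Fm (Dia A)#}) \<Longrightarrow>
    DKS4 (fill \<Sigma> {#White \<Delta>, Fm (Dia A)#})"
| Tb: "DKS4 (fill \<Sigma> {#Fm (Dia A), Fm A#}) \<Longrightarrow> DKS4 (fill \<Sigma> {#Fm (Dia A)#})"
| four_c: "DKS4 (fill \<Sigma> {#Fm (Dia A), White ({#Fm (Dia A)#} + \<Delta>)#}) \<Longrightarrow>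
    DKS4 (fill \<Sigma> {#Fm (Dia A), White \<Delta>#})"

text \<open>Propositional schemes over countably many schematic letters. An instance is brought into
  negation normal form, since \<open>PNot\<close> is interpreted by \<open>neg\<close>.\<close>

datatype pscheme =
    PVar nat
  | PNot pscheme
  | POr pscheme pscheme
  | PAnd pscheme pscheme

primrec peval :: "(nat \<Rightarrow> bool) \<Rightarrow> pscheme \<Rightarrow> bool" where
  "peval v (PVar n) \<longleftrightarrow> v n"
| "peval v (PNot P) \<longleftrightarrow> \<not> peval v P"
| "peval v (POr P Q) \<longleftrightarrow> peval v P \<or> peval v Q"
| "peval v (PAnd P Q) \<longleftrightarrow> peval v P \<and> peval v Q"

primrec inst :: "(nat \<Rightarrow> 'a fm) \<Rightarrow> pscheme \<Rightarrow> 'a fm" where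
  "inst \<sigma> (PVar n) = \<sigma> n"
| "inst \<sigma> (PNot P) = neg (inst \<sigma> P)"
| "inst \<sigma> (POr P Q) = Or (inst \<sigma> P) (inst \<sigma> Q)"
| "inst \<sigma> (PAnd P Q) = And (inst \<sigma> P) (inst \<sigma> Q)"

text \<open>The usual Hilbert system for S4. The logic lives in the purely modal language: the side
  conditions on the axioms make every theorem purely modal.\<close>

inductive S4 :: "'a fm \<Rightarrow> bool" where
  taut: "(\<And>v. peval v P) \<Longrightarrow> modal (inst \<sigma> P) \<Longrightarrow> S4 (inst \<sigma> P)"
| K: "modal A \<Longrightarrow> modal B \<Longrightarrow> S4 (imp (Box (imp A B)) (imp (Box A) (Box B)))"
| T: "modal A \<Longrightarrow> S4 (imp (Box A) A)"
| four: "modal A \<Longrightarrow> S4 (imp (Box A) (Box (Box A)))"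
| MP: "S4 (imp A B) \<Longrightarrow> S4 A \<Longrightarrow> S4 B"
| Nec: "S4 A \<Longrightarrow> S4 (Box A)"

end

theory Submission
  imports Defs
begin

text \<open>Both directions go through Kripke validity and a cut-free sequent calculus \<open>G\<close> for S4 whose
  sequents are sets of formulae. A saturation argument over the subformulae shows that \<open>G\<close> is
  complete for reflexive transitive frames. A \<open>G\<close>-proof turns into a \<open>DKS4\<close>-proof, where the
  \<open>4\<^sub>c\<close> rule carries the diamonds into the structure created by the box rule, and into an S4-proof.
  Both \<open>DKS4\<close> and S4 are sound for these frames.\<close>

section \<open>Kripke semantics\<close>

primrec sat :: "('w \<Rightarrow> 'w \<Rightarrow> bool) \<Rightarrow> ('w \<Rightarrow> 'a \<Rightarrow> bool) \<Rightarrow> 'a fm \<Rightarrow> 'w \<Rightarrow> bool" where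
  "sat R V (Atom a) w \<longleftrightarrow> V w a"
| "sat R V (NAtom a) w \<longleftrightarrow> \<not> V w a"
| "sat R V (Or A B) w \<longleftrightarrow> sat R V A w \<or> sat R V B w"
| "sat R V (And A B) w \<longleftrightarrow> sat R V A w \<and> sat R V B w"
| "sat R V (Box A) w \<longleftrightarrow> (\<forall>u. R w u \<longrightarrow> sat R V A u)"
| "sat R V (BBox A) w \<longleftrightarrow> (\<forall>u. R u w \<longrightarrow> sat R V A u)"
| "sat R V (Dia A) w \<longleftrightarrow> (\<exists>u. R w u \<and> sat R V A u)"
| "sat R V (BDia A) w \<longleftrightarrow> (\<exists>u. R u w \<and> sat R V A u)"

text \<open>Recursion runs through the multiset functor, so the world is abstracted after the
  contents are mapped to predicates. A structure reads as a future or past box over the disjunction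
  of its contents.\<close>

primrec sat_item :: "('w \<Rightarrow> 'w \<Rightarrow> bool) \<Rightarrow> ('w \<Rightarrow> 'a \<Rightarrow> bool) \<Rightarrow> 'a item \<Rightarrow> 'w \<Rightarrow> bool" where
  "sat_item R V (Fm A) = sat R V A"
| "sat_item R V (White \<Gamma>) =
    (\<lambda>w. \<forall>u. R w u \<longrightarrow> (\<exists>p \<in># image_mset (sat_item R V) \<Gamma>. p u))"
| "sat_item R V (Black \<Gamma>) =
    (\<lambda>w. \<forall>u. R u w \<longrightarrow> (\<exists>p \<in># image_mset (sat_item R V) \<Gamma>. p u))"

definition sat_nseq ::
    "('w \<Rightarrow> 'w \<Rightarrow> bool) \<Rightarrow> ('w \<Rightarrow> 'a \<Rightarrow> bool) \<Rightarrow> 'a nseq \<Rightarrow> 'w \<Rightarrow> bool" where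
  "sat_nseq R V \<Gamma> w \<longleftrightarrow> (\<exists>i \<in># \<Gamma>. sat_item R V i w)"

lemma sat_neg [simp]: "sat R V (neg A) w \<longleftrightarrow> \<not> sat R V A w"
  by (induction A arbitrary: w) auto

lemma sat_imp [simp]: "sat R V (imp A B) w \<longleftrightarrow> (sat R V A w \<longrightarrow> sat R V B w)"
  by (simp add: imp_def)

lemma sat_inst: "sat R V (inst \<sigma> P) w \<longleftrightarrow> peval (\<lambda>n. sat R V (\<sigma> n) w) P"
  by (induction P) auto

lemma sat_nseq_simps [simp]:
  "sat_nseq R V {#} w \<longleftrightarrow> False"
  "sat_nseq R V (add_mset i \<Gamma>) w \<longleftrightarrow> sat_item R V i w \<or> sat_nseq R V \<Gamma> w"
  "sat_nseq R V (\<Gamma> + \<Delta>) w \<longleftrightarrow> sat_nseq R V \<Gamma> w \<or> sat_nseq R V \<Delta> w"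
  by (auto simp: sat_nseq_def)

lemma sat_item_structure [simp]:
  "sat_item R V (White \<Gamma>) w \<longleftrightarrow> (\<forall>u. R w u \<longrightarrow> sat_nseq R V \<Gamma> u)"
  "sat_item R V (Black \<Gamma>) w \<longleftrightarrow> (\<forall>u. R u w \<longrightarrow> sat_nseq R V \<Gamma> u)"
  by (auto simp: sat_nseq_def)

declare sat_item.simps(2,3) [simp del]

section \<open>Soundness of nested sequents and of the Hilbert system\<close>

lemma sat_fill:
  assumes "\<And>w. sat_nseq R V X w"
  shows "sat_nseq R V (fill \<Sigma> X) w"
  using assms by (induction \<Sigma> arbitrary: w) auto

text \<open>A context adds side items disjunctively and quantifies universally over worlds; both
  preserve conjunction. Two premises serve the \<open>conj\<close> rule, and one-premise rules
  supply theirs twice.\<close>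

lemma sat_fill_mono:
  assumes "\<And>w. sat_nseq R V X w \<Longrightarrow> sat_nseq R V Y w \<Longrightarrow> sat_nseq R V Z w"
    and "sat_nseq R V (fill \<Sigma> X) w" and "sat_nseq R V (fill \<Sigma> Y) w"
  shows "sat_nseq R V (fill \<Sigma> Z) w"
  using assms(2,3)
proof (induction \<Sigma> arbitrary: w)
  case (Hole \<Gamma>)
  then show ?case using assms(1) by auto
qed auto

theorem DKS4_sound:
  assumes "DKS4 \<Gamma>" and refl: "reflp R"
    and trans: "transp R"
  shows "sat_nseq R V \<Gamma> w"
  using assms(1)
proof (induction arbitrary: w)
  case (id \<Sigma> a)
  show ?case by (rule sat_fill) simp
next
  case (conj \<Sigma> A B)
  show ?case by (rule sat_fill_mono[OF _ conj.IH]) auto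
next
  case (disj \<Sigma> A B)
  show ?case by (rule sat_fill_mono[OF _ disj.IH disj.IH]) auto
next
  case (box \<Sigma> A)
  show ?case by (rule sat_fill_mono[OF _ box.IH box.IH]) auto
next
  case (dia1 \<Sigma> \<Delta> A)
  show ?case by (rule sat_fill_mono[OF _ dia1.IH dia1.IH]) auto
next
  case (Tb \<Sigma> A)
  show ?case by (rule sat_fill_mono[OF _ Tb.IH Tb.IH]) (use refl in \<open>auto dest: reflpD\<close>)
next
  case (four_c \<Sigma> A \<Delta>)
  show ?case
    by (rule sat_fill_mono[OF _ four_c.IH four_c.IH]) (use trans in \<open>auto; meson transpD\<close>)
qed

theorem S4_sound:
  assumes "S4 A" and refl: "reflp R" and trans: "transp R"
  shows "sat R V A w"
  using assms(1)
proof (induction arbitrary: w)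
  case (taut P \<sigma>)
  then show ?case by (simp add: sat_inst)
next
  case (T A)
  then show ?case using refl by (auto dest: reflpD)
next
  case (four A)
  then show ?case using trans by (auto dest: transpD)
qed auto

section \<open>A cut-free calculus on sets of formulae\<close>

text \<open>Outside the \<open>box\<close> rule principal formulae stay, so contraction is built in.
  The \<open>box\<close> rule keeps whole diamonds, which reflects transitivity; \<open>dia\<close>
  reflects reflexivity.\<close>

inductive G :: "'a fm set \<Rightarrow> bool" where
  id: "Atom a \<in> X \<Longrightarrow> NAtom a \<in> X \<Longrightarrow> G X"
| disj: "Or A B \<in> X \<Longrightarrow> G (insert A (insert B X)) \<Longrightarrow> G X"
| conj: "And A B \<in> X \<Longrightarrow> G (insert A X) \<Longrightarrow> G (insert B X) \<Longrightarrow> G X"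
| dia: "Dia A \<in> X \<Longrightarrow> G (insert A X) \<Longrightarrow> G X"
| box: "Box A \<in> X \<Longrightarrow> G (insert A (X \<inter> range Dia)) \<Longrightarrow> G X"

text \<open>Weakening: side conditions are memberships, and the part
  \<open>X \<inter> range Dia\<close> kept by the \<open>box\<close> rule grows with
  \<open>X\<close>.\<close>

lemma G_mono: "G X \<Longrightarrow> X \<subseteq> Y \<Longrightarrow> G Y"
proof (induction arbitrary: Y rule: G.induct)
  case (id a X)
  then show ?case by (blast intro: G.id)
next
  case (disj A B X)
  have "G (insert A (insert B Y))" by (rule disj.IH) (use disj.prems in blast)
  then show ?case using G.disj disj.hyps(1) disj.prems by blast
next
  case (conj A B X)
  have "G (insert A Y)" "G (insert B Y)"
    using conj.IH insert_mono[OF conj.prems] by blast+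
  then show ?case using G.conj conj.hyps(1) conj.prems by blast
next
  case (dia A X)
  have "G (insert A Y)" using dia.IH insert_mono[OF dia.prems] by blast
  then show ?case using G.dia dia.hyps(1) dia.prems by blast
next
  case (box A X)
  have "G (insert A (Y \<inter> range Dia))" by (rule box.IH) (use box.prems in blast)
  then show ?case using G.box box.hyps(1) box.prems by blast
qed

section \<open>Subformulae, saturated sets and the countermodel\<close>

primrec subfms :: "'a fm \<Rightarrow> 'a fm set" where
  "subfms (Atom a) = {Atom a}"
| "subfms (NAtom a) = {NAtom a}"
| "subfms (Or A B) = insert (Or A B) (subfms A \<union> subfms B)"
| "subfms (And A B) = insert (And A B) (subfms A \<union> subfms B)"
| "subfms (Box A) = insert (Box A) (subfms A)"
| "subfms (BBox A) = insert (BBox A) (subfms A)"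
| "subfms (Dia A) = insert (Dia A) (subfms A)"
| "subfms (BDia A) = insert (BDia A) (subfms A)"

lemma finite_subfms: "finite (subfms A)"
  by (induction A) auto

lemma subfms_refl: "A \<in> subfms A"
  by (cases A) auto

lemma subfms_trans: "A \<in> subfms F \<Longrightarrow> subfms A \<subseteq> subfms F"
  by (induction F) auto

lemma subfms_closed:
  "Or A B \<in> subfms F \<Longrightarrow> A \<in> subfms F \<and> B \<in> subfms F"
  "And A B \<in> subfms F \<Longrightarrow> A \<in> subfms F \<and> B \<in> subfms F"
  "Box A \<in> subfms F \<Longrightarrow> A \<in> subfms F"
  "Dia A \<in> subfms F \<Longrightarrow> A \<in> subfms F"
  using subfms_trans[of "Or A B" F] subfms_trans[of "And A B" F] subfms_trans[of "Box A" F]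
    subfms_trans[of "Dia A" F] subfms_refl[of A] subfms_refl[of B]
  by auto

text \<open>By \<open>G_mono\<close>, testing one-formula extensions makes these the maximal
  unprovable sets of subformulae of \<open>F\<close>.\<close>

definition saturated :: "'a fm \<Rightarrow> 'a fm set \<Rightarrow> bool" where
  "saturated F X \<longleftrightarrow> X \<subseteq> subfms F \<and> \<not> G X \<and> (\<forall>A \<in> subfms F. A \<notin> X \<longrightarrow> G (insert A X))"

lemma saturated_extension:
  assumes "X \<subseteq> subfms F" and "\<not> G X"
  obtains Y where "X \<subseteq> Y" and "saturated F Y"
proof -
  let ?\<S> = "{Y. Y \<subseteq> subfms F \<and> \<not> G Y}"
  have "finite ?\<S>"
    by (rule finite_subset[of _ "Pow (subfms F)"]) (auto simp: finite_subfms)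
  with assms obtain Y where Y: "Y \<in> ?\<S>" "X \<subseteq> Y" "\<forall>Z \<in> ?\<S>. Y \<subseteq> Z \<longrightarrow> Y = Z"
    using finite_has_maximal2[of ?\<S> X] by auto
  have "saturated F Y"
    unfolding saturated_def
  proof (intro conjI ballI impI)
    fix A assume "A \<in> subfms F" "A \<notin> Y"
    then show "G (insert A Y)" using Y(1) Y(3)[rule_format, of "insert A Y"] by auto
  qed (use Y(1) in auto)
  with Y(2) that show thesis by blast
qed

text \<open>Equality is added because arbitrary sets of formulae serve as worlds, and the relation
  must be reflexive on all of them.\<close>

definition sat_rel :: "'a fm \<Rightarrow> 'a fm set \<Rightarrow> 'a fm set \<Rightarrow> bool" where
  "sat_rel F X Y \<longleftrightarrow> X = Y \<or> saturated F Y \<and> X \<inter> range Dia \<subseteq> Y"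

lemma reflp_sat_rel: "reflp (sat_rel F)"
  by (simp add: sat_rel_def reflp_def)

lemma transp_sat_rel: "transp (sat_rel F)"
  by (rule transpI) (auto simp: sat_rel_def)

lemma saturatedD:
  assumes "saturated F X"
  shows "\<not> G X" and "A \<in> X \<Longrightarrow> A \<in> subfms F"
    and "A \<in> subfms F \<Longrightarrow> \<not> G (insert A X) \<Longrightarrow> A \<in> X"
  using assms by (auto simp: saturated_def)

text \<open>Members of a saturated set are to be refuted, so a disjunction puts in both parts and a
  conjunction one. Each clause reads a \<open>G\<close> rule from an unprovable conclusion to an
  unprovable premise.\<close>

lemma saturated_closed:
  assumes X: "saturated F X"
  shows "Or A B \<in> X \<Longrightarrow> A \<in> X" and "Or A B \<in> X \<Longrightarrow> B \<in> X"
    and "And A B \<in> X \<Longrightarrow> A \<in> X \<or> B \<in> X" and "Dia A \<in> X \<Longrightarrow> A \<in> X"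
proof -
  show "A \<in> X" and "B \<in> X" if "Or A B \<in> X"
  proof -
    have "\<not> G (insert A (insert B X))" using G.disj[OF that] saturatedD(1)[OF X] by blast
    then have "\<not> G (insert A X)" "\<not> G (insert B X)"
      using G_mono[of "insert A X" "insert A (insert B X)"]
        G_mono[of "insert B X" "insert A (insert B X)"] by blast+
    moreover have "A \<in> subfms F" "B \<in> subfms F"
      using subfms_closed(1)[OF saturatedD(2)[OF X that]] by simp_all
    ultimately show "A \<in> X" "B \<in> X"
      using saturatedD(3)[OF X, of A] saturatedD(3)[OF X, of B] by simp_all
  qed
  show "A \<in> X \<or> B \<in> X" if "And A B \<in> X"
    using G.conj[OF that] saturatedD(1)[OF X] saturatedD(3)[OF X, of A] saturatedD(3)[OF X, of B]
      subfms_closed(2)[OF saturatedD(2)[OF X that]] by argo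
  show "A \<in> X" if "Dia A \<in> X"
    using G.dia[OF that] saturatedD(1)[OF X] saturatedD(3)[OF X, of A]
      subfms_closed(4)[OF saturatedD(2)[OF X that]] by argo
qed

text \<open>The truth lemma for the refuted side. \<open>sat_rel\<close> transfers formulae to
  successors only, hence the restriction to \<open>modal\<close> formulae.\<close>

lemma saturated_refutes:
  assumes "saturated F X" and "A \<in> X" and "modal A"
  shows "\<not> sat (sat_rel F) (\<lambda>Y a. Atom a \<notin> Y) A X"
  using assms
proof (induction A arbitrary: X)
  case (Atom a)
  then show ?case by simp
next
  case (NAtom a)
  show ?case using G.id[of a X] NAtom.prems(2) saturatedD(1)[OF NAtom.prems(1)] by auto
next
  case (Or A B)
  show ?case
    using Or.IH(1)[OF Or.prems(1) saturated_closed(1)[OF Or.prems(1,2)]]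
      Or.IH(2)[OF Or.prems(1) saturated_closed(2)[OF Or.prems(1,2)]] Or.prems(3) by simp
next
  case (And A B)
  show ?case
    using saturated_closed(3)[OF And.prems(1,2)] And.IH[OF And.prems(1)] And.prems(3) by auto
next
  case (Box A)
  \<comment> \<open>The unprovable premise of the \<open>box\<close> rule extends to a saturated
    successor that contains, and so refutes, \<open>A\<close>.\<close>
  have "insert A (X \<inter> range Dia) \<subseteq> subfms F"
    using saturatedD(2)[OF Box.prems(1)] subfms_closed(3)[OF saturatedD(2)[OF Box.prems(1,2)]]
    by blast
  moreover have "\<not> G (insert A (X \<inter> range Dia))"
    using G.box[OF Box.prems(2)] saturatedD(1)[OF Box.prems(1)] by blast
  ultimately obtain Y where Y: "insert A (X \<inter> range Dia) \<subseteq> Y" "saturated F Y"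
    by (rule saturated_extension)
  then have "sat_rel F X Y" by (simp add: sat_rel_def)
  moreover have "\<not> sat (sat_rel F) (\<lambda>Y a. Atom a \<notin> Y) A Y"
    using Box.IH[OF Y(2)] Box.prems(3) Y(1) by simp
  ultimately show ?case by (meson sat.simps(5))
next
  case (Dia A)
  have "\<not> sat (sat_rel F) (\<lambda>Y a. Atom a \<notin> Y) A Y" if "sat_rel F X Y" for Y
  proof -
    \<comment> \<open>\<open>Dia A\<close> reaches \<open>Y\<close> by equality or among the
      transferred diamonds; saturation then puts \<open>A\<close> in \<open>Y\<close>.\<close>
    have Y: "saturated F Y" "Dia A \<in> Y"
      using that Dia.prems(1,2) unfolding sat_rel_def by blast+
    then show ?thesis using Dia.IH[OF Y(1) saturated_closed(4)[OF Y]] Dia.prems(3) by simp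
  qed
  then show ?case by (meson sat.simps(7))
qed simp_all

text \<open>Validity is assumed only over the world type \<open>'a fm set\<close>, that of the
  countermodel. Saturation takes place among the subformulae of \<open>A\<close> itself.\<close>

theorem G_complete:
  fixes A :: "'a fm"
  assumes "modal A"
    and valid: "\<And>(R :: 'a fm set \<Rightarrow> 'a fm set \<Rightarrow> bool) V w. reflp R \<Longrightarrow> transp R \<Longrightarrow> sat R V A w"
  shows "G {A}"
proof (rule ccontr)
  assume "\<not> G {A}"
  then obtain X where "{A} \<subseteq> X" "saturated A X"
    using saturated_extension[of "{A}" A] subfms_refl[of A] by blast
  then show False
    using saturated_refutes[OF _ _ assms(1)] valid[OF reflp_sat_rel transp_sat_rel] by blast
qed

section \<open>From the set calculus to nested sequents\<close>

primrec comp_ctx :: "'a ctx \<Rightarrow> 'a ctx \<Rightarrow> 'a ctx" where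
  "comp_ctx (Hole \<Gamma>) \<Sigma> =
    (case \<Sigma> of Hole \<Delta> \<Rightarrow> Hole (\<Gamma> + \<Delta>) | InWhite \<Delta> \<Pi> \<Rightarrow> InWhite (\<Gamma> + \<Delta>) \<Pi>
      | InBlack \<Delta> \<Pi> \<Rightarrow> InBlack (\<Gamma> + \<Delta>) \<Pi>)"
| "comp_ctx (InWhite \<Gamma> \<Pi>) \<Sigma> = InWhite \<Gamma> (comp_ctx \<Pi> \<Sigma>)"
| "comp_ctx (InBlack \<Gamma> \<Pi>) \<Sigma> = InBlack \<Gamma> (comp_ctx \<Pi> \<Sigma>)"

lemma fill_fill: "fill \<Pi> (fill \<Sigma> X) = fill (comp_ctx \<Pi> \<Sigma>) X"
  by (induction \<Pi>) (auto split: ctx.split simp: add.assoc)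

text \<open>Rules act at any depth, so a derivation can be replayed inside \<open>\<Pi>\<close>.
  With side items in \<open>\<Pi>\<close> this includes weakening.\<close>

lemma DKS4_fill:
  assumes "DKS4 X"
  shows "DKS4 (fill \<Pi> X)"
  using assms
proof (induction rule: DKS4.induct)
  case id
  show ?case unfolding fill_fill by (rule DKS4.id)
next
  case conj
  from conj.IH show ?case unfolding fill_fill by (rule DKS4.conj)
next
  case disj
  from disj.IH show ?case unfolding fill_fill by (rule DKS4.disj)
next
  case box
  from box.IH show ?case unfolding fill_fill by (rule DKS4.box)
next
  case dia1
  from dia1.IH show ?case unfolding fill_fill by (rule DKS4.dia1)
next
  case Tb
  from Tb.IH show ?case unfolding fill_fill by (rule DKS4.Tb)
next
  case four_c
  from four_c.IH show ?case unfolding fill_fill by (rule DKS4.four_c)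
qed

text \<open>Iterates \<open>four_c\<close>: each inner diamond is absorbed by a copy outside the
  structure, which duplicates in \<open>D\<close> may share.\<close>

lemma DKS4_four_c_multi:
  assumes "DKS4 (\<Gamma> + {#White (image_mset Fm (\<Delta> + D))#})"
    and "set_mset D \<subseteq> range Dia" and "Fm ` set_mset D \<subseteq> set_mset \<Gamma>"
  shows "DKS4 (\<Gamma> + {#White (image_mset Fm \<Delta>)#})"
  using assms
proof (induction D arbitrary: \<Delta>)
  case (add B D)
  from add.prems obtain A where B: "B = Dia A" by auto
  from add.prems obtain \<Gamma>' where \<Gamma>: "\<Gamma> = add_mset (Fm B) \<Gamma>'" by (auto dest: multi_member_split)
  \<comment> \<open>\<open>B\<close> is counted among the items that remain; one further
    \<open>four_c\<close> then removes it.\<close>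
  have "DKS4 (\<Gamma> + {#White (image_mset Fm (add_mset B \<Delta>))#})"
    by (rule add.IH) (use add.prems in auto)
  then have "DKS4 (fill (Hole \<Gamma>') {#Fm (Dia A), White ({#Fm (Dia A)#} + image_mset Fm \<Delta>)#})"
    by (simp add: \<Gamma> B add_mset_commute)
  then show ?case using DKS4.four_c[of "Hole \<Gamma>'" A "image_mset Fm \<Delta>"]
    by (simp add: \<Gamma> B add_mset_commute)
qed simp

text \<open>\<open>M\<close> only has to cover \<open>X\<close>, so multiplicities and weakening
  need no separate treatment.\<close>

theorem G_imp_DKS4:
  assumes "G X" and "X \<subseteq> set_mset M"
  shows "DKS4 (image_mset Fm M)"
  using assms
proof (induction arbitrary: M rule: G.induct)
  case (id a X)
  then obtain M' where "M = M' + {#Atom a, NAtom a#}"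
    by (metis add_mset_add_single fm.distinct(1) insert_DiffM insert_noteq_member
        mset_add multi_member_split subsetD union_mset_add_mset_right)
  then show ?case using DKS4.id[of "Hole (image_mset Fm M')" a] by simp
next
  case (disj A B X)
  then obtain M' where M: "M = add_mset (Or A B) M'" by (meson mset_add subsetD)
  have "DKS4 (image_mset Fm (add_mset A (add_mset B M)))"
    by (rule disj.IH) (use disj.prems in auto)
  then show ?case using DKS4.disj[of "Hole (image_mset Fm M')" A B]
    by (simp add: M add_mset_commute)
next
  case (conj A B X)
  then obtain M' where M: "M = add_mset (And A B) M'" by (meson mset_add subsetD)
  have "DKS4 (image_mset Fm (add_mset A M))"
    by (rule conj.IH(1)) (use conj.prems in auto)
  moreover have "DKS4 (image_mset Fm (add_mset B M))"
    by (rule conj.IH(2)) (use conj.prems in auto)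
  ultimately show ?case using DKS4.conj[of "Hole (image_mset Fm M')" A B]
    by (simp add: M add_mset_commute)
next
  case (dia A X)
  then obtain M' where M: "M = add_mset (Dia A) M'" by (meson mset_add subsetD)
  have "DKS4 (image_mset Fm (add_mset A M))"
    by (rule dia.IH) (use dia.prems in auto)
  then show ?case using DKS4.Tb[of "Hole (image_mset Fm M')" A]
    by (simp add: M add_mset_commute)
next
  case (box A X)
  then obtain M' where M: "M = add_mset (Box A) M'" by (meson mset_add subsetD)
  \<comment> \<open>The derivation of \<open>A\<close> with the diamonds of \<open>M\<close> is
    placed in a new structure beside \<open>M\<close>; \<open>four_c\<close> then clears the
    diamonds from that structure.\<close>
  let ?D = "filter_mset (\<lambda>B. B \<in> range Dia) M"
  have "DKS4 (image_mset Fm ({#A#} + ?D))"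
    by (rule box.IH) (use box.prems in auto)
  then have "DKS4 (fill (InWhite (image_mset Fm M) (Hole {#})) (image_mset Fm ({#A#} + ?D)))"
    by (rule DKS4_fill)
  then have "DKS4 (image_mset Fm M + {#White (image_mset Fm ({#A#} + ?D))#})" by simp
  then have "DKS4 (image_mset Fm M + {#White (image_mset Fm {#A#})#})"
    by (rule DKS4_four_c_multi) auto
  then show ?case using DKS4.box[of "Hole (image_mset Fm M')" A]
    by (simp add: M add_mset_commute)
qed

section \<open>From the set calculus to the Hilbert system\<close>

lemma neg_neg [simp]: "neg (neg A) = A"
  by (induction A) auto

lemma modal_neg [simp]: "modal (neg A) = modal A"
  by (induction A) auto

lemma modal_imp [simp]: "modal (imp A B) \<longleftrightarrow> modal A \<and> modal B"
  by (simp add: imp_def)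

lemma S4_modal: "S4 A \<Longrightarrow> modal A"
  by (induction rule: S4.induct) auto

text \<open>Closure under propositional consequence, by a tautology and two uses of
  \<open>MP\<close>.\<close>

lemma S4_consequence:
  assumes "S4 (inst \<sigma> P)" and "S4 (inst \<sigma> Q)" and "modal (inst \<sigma> R)"
    and "\<And>v. peval v P \<Longrightarrow> peval v Q \<Longrightarrow> peval v R"
  shows "S4 (inst \<sigma> R)"
proof -
  let ?S = "POr (PNot P) (POr (PNot Q) R)"
  have "S4 (inst \<sigma> ?S)"
    by (rule S4.taut) (use assms S4_modal in auto)
  then have "S4 (imp (inst \<sigma> P) (imp (inst \<sigma> Q) (inst \<sigma> R)))" by (simp add: imp_def)
  then show ?thesis using assms(1,2) S4.MP by blast
qed

lemma S4_imp_refl: "modal A \<Longrightarrow> S4 (imp A A)"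
  using S4.taut[of "POr (PNot (PVar 0)) (PVar 0)" "\<lambda>_. A"] by (simp add: imp_def)

lemma S4_imp_trans:
  assumes "S4 (imp A B)" and "S4 (imp B C)"
  shows "S4 (imp A C)"
  \<comment> \<open>The list supplies the substitution; only letters below its length occur in the
    schemes.\<close>
  using S4_consequence[of "nth [A, B, C]" "POr (PNot (PVar 0)) (PVar 1)"
      "POr (PNot (PVar 1)) (PVar 2)" "POr (PNot (PVar 0)) (PVar 2)"]
    assms S4_modal[OF assms(1)] S4_modal[OF assms(2)]
  by (auto simp: imp_def)

lemma S4_imp_OrI:
  assumes "modal A" and "modal B"
  shows "S4 (imp A (Or A B))" and "S4 (imp B (Or A B))"
  using S4.taut[of "POr (PNot (PVar 0)) (POr (PVar 0) (PVar 1))" "nth [A, B]"]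
    S4.taut[of "POr (PNot (PVar 1)) (POr (PVar 0) (PVar 1))" "nth [A, B]"] assms
  by (auto simp: imp_def)

lemma S4_AndI:
  assumes "S4 A" and "S4 B"
  shows "S4 (And A B)"
  using S4_consequence[of "nth [A, B]" "PVar 0" "PVar 1" "PAnd (PVar 0) (PVar 1)"]
    assms S4_modal[OF assms(1)] S4_modal[OF assms(2)]
  by auto

lemma S4_imp_Or:
  assumes "S4 (imp A C)" and "S4 (imp B C)"
  shows "S4 (imp (Or A B) C)"
  using S4_consequence[of "nth [A, B, C]" "POr (PNot (PVar 0)) (PVar 2)"
      "POr (PNot (PVar 1)) (PVar 2)" "POr (PNot (POr (PVar 0) (PVar 1))) (PVar 2)"]
    assms S4_modal[OF assms(1)] S4_modal[OF assms(2)]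
  by (auto simp: imp_def)

lemma S4_Or_commute:
  assumes "S4 (Or A B)"
  shows "S4 (Or B A)"
  using S4_consequence[of "nth [A, B]" "POr (PVar 0) (PVar 1)" "POr (PVar 0) (PVar 1)"
      "POr (PVar 1) (PVar 0)"] assms S4_modal[OF assms]
  by auto

lemma S4_cases:
  assumes "S4 (Or A B)" and "S4 (imp A C)" and "S4 (imp B C)"
  shows "S4 C"
  using S4_imp_Or[OF assms(2,3)] assms(1) S4.MP by blast

lemma S4_excluded_middle: "modal A \<Longrightarrow> S4 (Or A (neg A))"
  using S4_imp_refl[of "neg A"] by (simp add: imp_def)

lemma S4_imp_And_cases:
  assumes "S4 (Or A C)" and "S4 (Or B C)" and "S4 (imp (And A B) C)"
  shows "S4 C"
proof -
  have AC: "S4 (And (Or A C) (Or B C))" using assms S4_AndI by blast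
  then show ?thesis
    using S4_consequence[of "nth [A, B, C]" "PAnd (POr (PVar 0) (PVar 2)) (POr (PVar 1) (PVar 2))"
        "POr (PNot (PAnd (PVar 0) (PVar 1))) (PVar 2)" "PVar 2"] assms(3) S4_modal[OF AC]
    by (auto simp: imp_def)
qed

text \<open>In negation normal form, \<open>T\<close> at \<open>neg A\<close> is
  \<open>Or (Dia A) (neg A)\<close>, so contraposition is commutation of \<open>Or\<close>. The
  axiom \<open>four\<close> dualises in the same way.\<close>

lemma S4_imp_Dia: "modal A \<Longrightarrow> S4 (imp A (Dia A))"
  using S4.T[of "neg A"] S4_Or_commute by (fastforce simp: imp_def)

lemma S4_Dia_Dia: "modal A \<Longrightarrow> S4 (imp (Dia (Dia A)) (Dia A))"
  using S4.four[of "neg A"] S4_Or_commute by (fastforce simp: imp_def)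

lemma S4_Box_Or:
  "modal A \<Longrightarrow> modal B \<Longrightarrow> S4 (imp (Box (Or A B)) (Or (Dia A) (Box B)))"
  using S4.K[of "neg A" B] by (simp add: imp_def)

text \<open>The hypothesis on \<open>D\<close> is a second-order encoding of provability of the disjunction of
  \<open>A\<close> and the formulae \<open>Dia B\<close>, which avoids choosing an order for the disjuncts. The
  diamonds are moved into \<open>A\<close> one by one.\<close>

lemma S4_box_step:
  assumes "finite Y" and "modal A"
    and "\<And>D. modal D \<Longrightarrow> S4 (imp A D) \<Longrightarrow> (\<And>B. B \<in> Y \<Longrightarrow> S4 (imp (Dia B) D)) \<Longrightarrow> S4 D"
    and "S4 (imp (Box A) C)" and "\<And>B. B \<in> Y \<Longrightarrow> S4 (imp (Dia B) C)"
  shows "S4 C"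
  using assms
proof (induction Y arbitrary: A rule: finite_induct)
  case empty
  \<comment> \<open>With no diamonds left, taking \<open>D\<close> as \<open>A\<close> yields
    \<open>S4 A\<close>, ready for necessitation.\<close>
  have "S4 A" using empty.prems(2)[of A] empty.prems(1) S4_imp_refl by auto
  then show ?case using empty.prems(3) S4.Nec S4.MP by blast
next
  case (insert B Y)
  have BC: "S4 (imp (Dia B) C)" using insert.prems(4) by simp
  then have B: "modal B" using S4_modal by fastforce
  let ?A = "Or (Dia B) A"
  show ?case
  proof (rule insert.IH[of ?A])
    show "modal ?A" using B insert.prems(1) by simp
    show "S4 (imp (Dia B') C)" if "B' \<in> Y" for B' using insert.prems(4) that by simp
    \<comment> \<open>Distributing the box over \<open>?A\<close> turns \<open>Dia B\<close> into
      \<open>Dia (Dia B)\<close>, which \<open>S4_Dia_Dia\<close> collapses.\<close>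
    have "S4 (imp (Or (Dia (Dia B)) (Box A)) C)"
      using S4_imp_Or S4_imp_trans[OF S4_Dia_Dia[OF B] BC] insert.prems(3) by blast
    then show "S4 (imp (Box ?A) C)"
      using S4_imp_trans S4_Box_Or[of "Dia B" A] B insert.prems(1) by fastforce
  next
    fix D
    assume D: "modal D" "S4 (imp ?A D)" "\<And>B'. B' \<in> Y \<Longrightarrow> S4 (imp (Dia B') D)"
    have "S4 (imp (Dia B) D)" "S4 (imp A D)"
      using S4_imp_OrI[of "Dia B" A] S4_imp_trans[OF _ D(2)] B insert.prems(1) by auto
    then show "S4 D" using insert.prems(2)[of D] D by auto
  qed
qed

text \<open>\<open>C\<close> is an arbitrary upper bound of \<open>X\<close> under provable
  implication, which encodes provability of the disjunction of \<open>X\<close> as in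
  \<open>S4_box_step\<close>.\<close>

theorem G_imp_S4:
  assumes "G X" and "finite X" and "modal C" and "\<And>B. B \<in> X \<Longrightarrow> S4 (imp B C)"
  shows "S4 C"
  using assms
proof (induction arbitrary: C rule: G.induct)
  case (id a X)
  then show ?case using S4_cases[of "Atom a" "NAtom a" C] S4_excluded_middle[of "Atom a"] by simp
next
  case (disj A B X)
  have AB: "S4 (imp (Or A B) C)" using disj.prems(3) disj.hyps(1) by blast
  then have m: "modal A" "modal B" using S4_modal[OF AB] by auto
  have "S4 (imp A C)" "S4 (imp B C)"
    by (rule S4_imp_trans[OF S4_imp_OrI(1)[OF m] AB], rule S4_imp_trans[OF S4_imp_OrI(2)[OF m] AB])
  with disj.prems have "S4 (imp D C)" if "D \<in> insert A (insert B X)" for D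
    using that by blast
  then show ?case by (rule disj.IH[rotated -1]) (use disj.prems in simp_all)
next
  case (conj A B X)
  have AB: "S4 (imp (And A B) C)" using conj.prems(3) conj.hyps(1) by blast
  then have m: "modal A" "modal B" using S4_modal[OF AB] by auto
  \<comment> \<open>\<open>C\<close> need not bound \<open>A\<close> or \<open>B\<close>, so the
    induction hypotheses are applied to \<open>Or A C\<close> and \<open>Or B C\<close>.\<close>
  have X: "S4 (imp D (Or E C))" if "D \<in> X" "modal E" for D E
    by (rule S4_imp_trans[OF conj.prems(3)[OF that(1)] S4_imp_OrI(2)[OF that(2) conj.prems(2)]])
  have "S4 (Or A C)"
  proof (rule conj.IH(1))
    show "S4 (imp D (Or A C))" if "D \<in> insert A X" for D
      using that X m S4_imp_OrI(1)[OF m(1) conj.prems(2)] by blast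
  qed (use conj.prems m in simp_all)
  moreover have "S4 (Or B C)"
  proof (rule conj.IH(2))
    show "S4 (imp D (Or B C))" if "D \<in> insert B X" for D
      using that X m S4_imp_OrI(1)[OF m(2) conj.prems(2)] by blast
  qed (use conj.prems m in simp_all)
  ultimately show ?case using AB by (rule S4_imp_And_cases)
next
  case (dia A X)
  have AC: "S4 (imp (Dia A) C)" using dia.prems(3) dia.hyps(1) by blast
  then have "S4 (imp A C)" using S4_imp_trans[OF S4_imp_Dia AC] S4_modal[OF AC] by simp
  with dia.prems(3) have "S4 (imp D C)" if "D \<in> insert A X" for D
    using that by blast
  then show ?case by (rule dia.IH[rotated -1]) (use dia.prems in simp_all)
next
  case (box A X)
  have AC: "S4 (imp (Box A) C)" using box.prems(3) box.hyps(1) by blast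
  \<comment> \<open>The induction hypothesis is used for every bound \<open>D\<close> of the
    premise, as the second-order hypothesis of \<open>S4_box_step\<close> asks.\<close>
  show ?case
  proof (rule S4_box_step[of "{B. Dia B \<in> X}" A])
    show "finite {B. Dia B \<in> X}"
      using finite_vimageI[OF box.prems(1), of Dia] by (simp add: vimage_def inj_def)
    show "modal A" using S4_modal[OF AC] by simp
    show "S4 D" if "modal D" "S4 (imp A D)" "\<And>B. B \<in> {B. Dia B \<in> X} \<Longrightarrow> S4 (imp (Dia B) D)" for D
      by (rule box.IH) (use that box.prems(1) in auto)
  qed (use AC box.prems in auto)
qed

theorem theorem5p8:
  fixes A :: "'a fm"
  assumes "modal A"
  shows "DKS4 {#Fm A#} \<longleftrightarrow> S4 A"
proof
  assume A: "DKS4 {#Fm A#}"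
  have "sat R V A w" if "reflp R" "transp R" for R :: "'a fm set \<Rightarrow> 'a fm set \<Rightarrow> bool" and V w
    using DKS4_sound[OF A that] by simp
  then have "G {A}" by (rule G_complete[OF assms])
  then show "S4 A" by (rule G_imp_S4) (use assms S4_imp_refl in auto)
next
  assume "S4 A"
  then have "G {A}" by (intro G_complete assms S4_sound)
  then show "DKS4 {#Fm A#}" using G_imp_DKS4[of "{A}" "{#A#}"] by simp
qed

end
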